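(* Consider finite groups $G$ with $|C(G)|=\frac{|G|}{2}+1$. The following hold. (1) There are infinitely many such groups $G$ (up to isomorphism) with $\mathcal{O}_{2}(G)=1$. (2) There is no such group $G$ with $\mathcal{O}_{2}(G)=3$. (3) For such $G$: $\mathcal{O}_{2}(G)=\frac{|G|}{2}$ if and only if $G\cong\mathbb{Z}_{2}$. (4) For such $G$: $\mathcal{O}_{2}(G)=\frac{|G|}{2}-1$ if and only if $G\cong\mathbb{Z}_{4}$. (5) For such $G$: $\mathcal{O}_{2}(G)=\frac{|G|}{2}-2$ if and only if $G\cong\mathbb{Z}_{6}$.
   Context: For a finite group $G$, $C(G)$ is the set of all cyclic subgroups of $G$ (including the trivial one), and $\mathcal{O}_2(G)$ is the number of elements of order $2$ in $G$. $\mathbb{Z}_n$ is the cyclic group of order $n$. *)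

theory Defs
  imports Complex_Main "HOL-Algebra.Algebra"
begin

definition cyclic_subgroups :: "('a, 'b) monoid_scheme \<Rightarrow> 'a set set" where
  "cyclic_subgroups G = {H. subgroup H G \<and> cyclic_group (G\<lparr>carrier := H\<rparr>)}"

definition num_involutions :: "('a, 'b) monoid_scheme \<Rightarrow> nat" where
  "num_involutions G = card {x \<in> carrier G. group.ord G x = 2}"

text \<open>The equation is stated over the reals, so that the half is not truncated;
  over the naturals the trivial group would satisfy it.\<close>

definition half_cyclic_group :: "('a, 'b) monoid_scheme \<Rightarrow> bool" where
  "half_cyclic_group G \<longleftrightarrow> group G \<and> finite (carrier G) \<and>
     real (card (cyclic_subgroups G)) = real (order G) / 2 + 1"

end

theory Submission
  imports Defs "HOL-Number_Theory.Totient"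
begin

text \<open>
  A cyclic subgroup of order \<open>n\<close> has \<open>\<phi>(n)\<close> generators, so sorting the elements of \<open>G\<close>
  by the subgroup they generate gives \<open>|G| = 1 + i + \<Sum> \<phi>(|H|)\<close>, where \<open>i\<close> is the number of involutions
  and \<open>H\<close> runs over the set \<open>L\<close> of cyclic subgroups of order at least 3. Together with
  \<open>|C(G)| = 1 + i + |L|\<close> the hypothesis becomes
  \<open>i - 1 = \<Sum> (\<phi>(|H|) - 2)\<close>, or equivalently \<open>|L| = |G|/2 - i\<close>.

  For \<open>i = 1\<close> all element orders lie in \<open>{1, 2, 3, 4, 6}\<close>, as in \<open>\<int>\<^sub>6 \<times> \<int>\<^sub>3\<^sup>k\<close>.
  For \<open>i = 3\<close> exactly one member of \<open>L\<close> has \<open>\<phi> = 4\<close>, hence order 5, 8, 10 or 12,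
  and the conjugation action of its generator on the three involutions excludes 5, 8 and 12,
  while order 10 would give a second member with \<open>\<phi> = 4\<close>, of order 5.
  Parts (3), (4), (5) say \<open>|L| = 0, 1, 2\<close>; the equation \<open>\<Sum> \<phi>(|H|) = |G|/2 - 1 + |L|\<close> then
  forces an element of order \<open>|G|\<close> or, for \<open>|L| = 2\<close>, of odd order \<open>|G|/2\<close>.
\<close>

section \<open>Counting cyclic subgroups\<close>

text \<open>A generator has the same powers in \<open>H\<close> as in \<open>G\<close>. From here on
  a cyclic subgroup is always handled through one of its generators.\<close>

lemma (in group) cyclic_subgroups_eq_generate:
  "cyclic_subgroups G = (\<lambda>x. generate G {x}) ` carrier G"
proof (intro equalityI subsetI)
  fix H assume "H \<in> cyclic_subgroups G"
  then have H: "subgroup H G" and cyc: "cyclic_group (G\<lparr>carrier := H\<rparr>)"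
    by (auto simp: cyclic_subgroups_def)
  interpret H: group "G\<lparr>carrier := H\<rparr>"
    using H by (simp add: subgroup_imp_group)
  obtain x where x: "x \<in> H" "H = range (\<lambda>n::int. x [^]\<^bsub>G\<lparr>carrier := H\<rparr>\<^esub> n)"
    using cyc H.cyclic_group by auto
  have "H = range (\<lambda>n::int. x [^] n)"
    using x int_pow_consistent[OF H x(1)] by simp
  moreover have "x \<in> carrier G"
    using H x(1) subgroup.mem_carrier by metis
  ultimately show "H \<in> (\<lambda>x. generate G {x}) ` carrier G"
    by (auto simp: generate_pow)
next
  fix H assume "H \<in> (\<lambda>x. generate G {x}) ` carrier G"
  then obtain x where x: "x \<in> carrier G" "H = generate G {x}" by auto
  have "subgroup H G" using x generate_is_subgroup by simp
  moreover have "subgroup_generated G {x} = G\<lparr>carrier := H\<rparr>"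
    using x by (simp add: subgroup_generated_def)
  ultimately show "H \<in> cyclic_subgroups G"
    using cyclic_group_generated[of x] by (simp add: cyclic_subgroups_def)
qed

lemma (in group) finite_cyclic_subgroups:
  "finite (carrier G) \<Longrightarrow> finite (cyclic_subgroups G)"
  by (simp add: cyclic_subgroups_eq_generate)

lemma (in group) mem_generate_self: "x \<in> generate G {x}"
  by (simp add: generate.incl)

lemma (in group) mem_generate_iff:
  assumes "finite (carrier G)" "x \<in> carrier G"
  shows "y \<in> generate G {x} \<longleftrightarrow> (\<exists>k::nat. y = x [^] k)"
  using generate_pow_on_finite_carrier[OF assms] by auto

text \<open>Membership of \<open>y\<close> gives one inclusion, and equal finite cardinalities turn
  it into equality.\<close>

lemma (in group) generate_eq_iff:
  assumes fin: "finite (carrier G)" and x: "x \<in> carrier G" and y: "y \<in> carrier G"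
  shows "generate G {y} = generate G {x} \<longleftrightarrow> y \<in> generate G {x} \<and> ord y = ord x"
proof
  assume "generate G {y} = generate G {x}"
  then show "y \<in> generate G {x} \<and> ord y = ord x"
    using mem_generate_self generate_pow_card x y by metis
next
  assume *: "y \<in> generate G {x} \<and> ord y = ord x"
  have sub: "subgroup (generate G {x}) G"
    using x generate_is_subgroup by simp
  have "generate G {y} \<subseteq> generate G {x}"
    using * sub by (simp add: generate_subgroup_incl)
  moreover have "finite (generate G {x})"
    using sub fin subgroup.subset finite_subset by metis
  ultimately show "generate G {y} = generate G {x}"
    using * x y generate_pow_card card_subset_eq by metis
qed

text \<open>The generators are exactly the powers \<open>x [^] k\<close> with \<open>k\<close>
  coprime to \<open>ord x\<close>, and distinct totatives give distinct powers.\<close>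

lemma (in group) card_generators:
  assumes fin: "finite (carrier G)" and x: "x \<in> carrier G"
  shows "card {y \<in> carrier G. generate G {y} = generate G {x}} = totient (ord x)"
proof -
  have pos: "ord x > 0" using ord_ge_1[OF assms] by simp
  have "{y \<in> carrier G. generate G {y} = generate G {x}} = (\<lambda>k. x [^] k) ` totatives (ord x)"
  proof (intro equalityI subsetI)
    fix y assume "y \<in> {y \<in> carrier G. generate G {y} = generate G {x}}"
    then have y: "y \<in> carrier G" "y \<in> generate G {x}" "ord y = ord x"
      using generate_eq_iff[OF fin x] by auto
    then obtain k :: nat where k: "y = x [^] k" using mem_generate_iff[OF fin x] by auto
    \<comment> \<open>\<open>totatives\<close> takes its representatives from 1 up to
      \<open>ord x\<close>, so the residue 0 is replaced by \<open>ord x\<close>; this matters when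
      \<open>ord x = 1\<close>.\<close>
    define r where "r = (if k mod ord x = 0 then ord x else k mod ord x)"
    have yr: "y = x [^] r"
    proof -
      have "x [^] k = x [^] (ord x * (k div ord x) + k mod ord x)" by simp
      also have "\<dots> = (x [^] ord x) [^] (k div ord x) \<otimes> x [^] (k mod ord x)"
        using x by (simp only: nat_pow_mult nat_pow_pow nat_pow_closed)
      also have "\<dots> = x [^] (k mod ord x)" using x by simp
      also have "\<dots> = x [^] r" using x by (simp add: r_def)
      finally show ?thesis using k by simp
    qed
    then have "coprime r (ord x)"
      using y pow_ord_eq_ord_iff[OF fin x] by simp
    moreover have "0 < r" "r \<le> ord x" using pos by (auto simp: r_def intro: less_imp_le)
    ultimately have "r \<in> totatives (ord x)" by (simp add: in_totatives_iff)
    then show "y \<in> (\<lambda>k. x [^] k) ` totatives (ord x)" using yr by auto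
  next
    fix y assume "y \<in> (\<lambda>k. x [^] k) ` totatives (ord x)"
    then obtain k where k: "y = x [^] k" "coprime k (ord x)"
      by (auto simp: in_totatives_iff)
    then have "ord y = ord x" using pow_ord_eq_ord_iff[OF fin x] by simp
    moreover have "y \<in> carrier G" using k x by simp
    ultimately show "y \<in> {y \<in> carrier G. generate G {y} = generate G {x}}"
      using generate_eq_iff[OF fin x] mem_generate_iff[OF fin x] k by auto
  qed
  moreover have "inj_on (\<lambda>k. x [^] k) (totatives (ord x))"
    using ord_inj'[OF x] by (rule inj_on_subset) (auto simp: in_totatives_iff)
  ultimately show ?thesis
    by (simp add: card_image totient_def)
qed

text \<open>Elements are counted along the fibres of the map sending \<open>x\<close> to
  \<open>generate G {x}\<close>. The predicate \<open>P\<close> lets one identity serve for order 1,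
  for order 2 and for the whole group.\<close>

lemma (in group) card_ord_eq_sum_totient:
  assumes fin: "finite (carrier G)"
  shows "card {x \<in> carrier G. P (ord x)} = (\<Sum>H | H \<in> cyclic_subgroups G \<and> P (card H). totient (card H))"
proof -
  let ?A = "{x \<in> carrier G. P (ord x)}" and ?B = "{H \<in> cyclic_subgroups G. P (card H)}"
  have "card ?A = (\<Sum>x\<in>?A. 1)" by simp
  also have "\<dots> = (\<Sum>H\<in>?B. \<Sum>x\<in>{x \<in> ?A. generate G {x} = H}. 1)"
    using fin finite_cyclic_subgroups
    by (intro sum.group[symmetric]) (auto simp: cyclic_subgroups_eq_generate simp flip: generate_pow_card)
  also have "\<dots> = (\<Sum>H\<in>?B. totient (card H))"
  proof (rule sum.cong)
    fix H assume H: "H \<in> ?B"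
    then obtain x where x: "x \<in> carrier G" "H = generate G {x}"
      by (auto simp: cyclic_subgroups_eq_generate)
    have "{y \<in> ?A. generate G {y} = H} = {y \<in> carrier G. generate G {y} = generate G {x}}"
      using H x by (auto, metis generate_pow_card)
    then show "(\<Sum>x\<in>{x \<in> ?A. generate G {x} = H}. 1) = totient (card H)"
      using card_generators[OF fin x(1)] x generate_pow_card by simp
  qed simp
  finally show ?thesis .
qed

text \<open>This is the set \<open>L\<close> of the overview. The threshold is 3 because the orders
  1 and 2 have totient 1, while from 3 on the totient is even and at least 2.\<close>

definition large_cyclic_subgroups :: "('a, 'b) monoid_scheme \<Rightarrow> 'a set set" where
  "large_cyclic_subgroups G = {H \<in> cyclic_subgroups G. 3 \<le> card H}"

lemma (in group) cyclic_subgroup_card_pos: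
  assumes "finite (carrier G)" "H \<in> cyclic_subgroups G"
  shows "0 < card H"
  using assms ord_ge_1 generate_pow_card by (fastforce simp: cyclic_subgroups_eq_generate)

text \<open>In orders 1 and 2 subgroups and elements are equally many, since the totient is 1. The
  two counts therefore differ only in the contribution of the large subgroups.\<close>

lemma (in group) order_eq_sum_totient:
  assumes fin: "finite (carrier G)"
  shows "order G = 1 + num_involutions G + (\<Sum>H\<in>large_cyclic_subgroups G. totient (card H))"
    and card_cyclic_subgroups_eq:
      "card (cyclic_subgroups G) = 1 + num_involutions G + card (large_cyclic_subgroups G)"
proof -
  let ?B = "\<lambda>P. {H \<in> cyclic_subgroups G. P (card H)}"
  let ?B1 = "?B (\<lambda>n. n = 1)" and ?B2 = "?B (\<lambda>n. n = 2)" and ?L = "large_cyclic_subgroups G"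
  have finB: "finite ?B1" "finite ?B2" "finite (?B1 \<union> ?B2)" "finite ?L"
    using finite_cyclic_subgroups[OF fin] by (simp_all add: large_cyclic_subgroups_def)
  have disj: "?B1 \<inter> ?B2 = {}" "(?B1 \<union> ?B2) \<inter> ?L = {}"
    by (auto simp: large_cyclic_subgroups_def)
  have "{x \<in> carrier G. ord x = 1} = {\<one>}" using ord_eq_1 by auto
  then have 1: "card ?B1 = 1"
    using card_ord_eq_sum_totient[OF fin, of "\<lambda>n. n = 1"] by simp
  have 2: "card ?B2 = num_involutions G"
    using card_ord_eq_sum_totient[OF fin, of "\<lambda>n. n = 2"] by (simp add: num_involutions_def)
  have split: "cyclic_subgroups G = (?B1 \<union> ?B2) \<union> ?L"
    using cyclic_subgroup_card_pos[OF fin] by (force simp: large_cyclic_subgroups_def)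
  have "card (cyclic_subgroups G) = card (?B1 \<union> ?B2) + card ?L"
    using card_Un_disjoint[OF finB(3,4) disj(2)] split by simp
  then show "card (cyclic_subgroups G) = 1 + num_involutions G + card ?L"
    using card_Un_disjoint[OF finB(1,2) disj(1)] 1 2 by simp
  have "order G = (\<Sum>H\<in>cyclic_subgroups G. totient (card H))"
    using card_ord_eq_sum_totient[OF fin, of "\<lambda>_. True"] by (simp add: order_def)
  also have "\<dots> = (\<Sum>H\<in>?B1 \<union> ?B2. totient (card H)) + (\<Sum>H\<in>?L. totient (card H))"
    using sum.union_disjoint[OF finB(3,4) disj(2), of "\<lambda>H. totient (card H)"] split by simp
  also have "(\<Sum>H\<in>?B1 \<union> ?B2. totient (card H)) = card ?B1 + card ?B2"
    using sum.union_disjoint[OF finB(1,2) disj(1), of "\<lambda>H. totient (card H)"] by simp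
  finally show "order G = 1 + num_involutions G + (\<Sum>H\<in>?L. totient (card H))"
    using 1 2 by simp
qed

section \<open>Numbers with totient 4\<close>

text \<open>A divisor of \<open>n\<close> has totient at most 4, which rules out the primes above 5
  and the prime powers 16, 9 and 25 as divisors; and 120 is 8 * 3 * 5.\<close>

lemma totient_dvd_4_imp_dvd_120:
  assumes "totient n dvd 4"
  shows "n dvd (120::nat)"
proof (rule multiplicity_le_imp_dvd)
  show n: "n \<noteq> 0" using assms by (intro notI) simp
  have small: "totient d \<le> 4" if "d dvd n" for d
    using totient_dvd[OF that] assms dvd_trans dvd_imp_le by (metis zero_less_numeral)
  fix p :: nat assume p: "Factorial_Ring.prime p"
  define e where "e = multiplicity p n"
  have pe: "p ^ e dvd n" by (simp add: e_def multiplicity_dvd)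
  have "p ^ e dvd 120"
  proof (cases "e = 0")
    case False
    then have "p dvd n" using pe dvd_trans dvd_power by blast
    then have "p - 1 \<le> 4" using small[of p] totient_prime[OF p] by simp
    then have "p \<in> {0,1,2,3,4,5}" by auto
    moreover have "\<not> Factorial_Ring.prime (4::nat)" by simp
    ultimately consider "p = 2" | "p = 3" | "p = 5" using p by (auto simp del: prime_nat_numeral_eq)
    then show ?thesis
    proof cases
      case 1
      have "totient 16 = 8" by code_simp
      then have "\<not> 16 dvd n" using small by force
      then have "\<not> 4 \<le> e" using 1 pe power_le_dvd[of p e n 4] by auto
      then have "e \<le> 3" by simp
      then have "p ^ e dvd 2 ^ 3" using 1 le_imp_power_dvd by blast
      then show ?thesis by (rule dvd_trans) simp
    next
      case 2
      have "totient 9 = 6" by code_simp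
      then have "\<not> 9 dvd n" using small by force
      then have "\<not> 2 \<le> e" using 2 pe power_le_dvd[of p e n 2] by auto
      then have "e \<le> 1" by simp
      then have "p ^ e dvd 3 ^ 1" using 2 le_imp_power_dvd by blast
      then show ?thesis by (rule dvd_trans) simp
    next
      case 3
      have "totient 25 = 20" by code_simp
      then have "\<not> 25 dvd n" using small by force
      then have "\<not> 2 \<le> e" using 3 pe power_le_dvd[of p e n 2] by auto
      then have "e \<le> 1" by simp
      then have "p ^ e dvd 5 ^ 1" using 3 le_imp_power_dvd by blast
      then show ?thesis by (rule dvd_trans) simp
    qed
  qed simp
  then show "multiplicity p n \<le> multiplicity p 120"
    using prime_gt_1_nat[OF p] multiplicity_geI[of 120 p e] by (simp add: e_def)
qed

text \<open>The divisors of 120 other than 1, 2, 3, 4, 5, 6, 8, 10, 12 are multiples of 15, 20 or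
  24, which all have totient 8. Of the listed numbers, 1, 2, 3, 4 and 6 have totient 1 or 2.\<close>

lemma totient_eq_4_imp:
  assumes "totient n = 4"
  shows "n \<in> {5, 8, 10, 12}"
proof -
  have "n dvd 120" using assms totient_dvd_4_imp_dvd_120 by simp
  then have n: "n \<in> set [1..<121]" "120 mod n = 0"
    using dvd_imp_le[of n 120] by (auto simp: Suc_le_eq intro: Nat.gr0I)
  have "\<forall>n \<in> set [1..<121]. 120 mod n = 0 \<longrightarrow>
      n \<in> set [1, 2, 3, 4, 5, 6, 8, 10, 12] \<or> n mod 15 = 0 \<or> n mod 20 = 0 \<or> n mod 24 = (0::nat)"
    by code_simp
  note cases = mp[OF bspec[OF this n(1)] n(2)]
  have small: "totient d \<le> 4" if "d dvd n" for d
    using totient_dvd[OF that] assms by (simp add: dvd_imp_le)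
  have "totient 15 = 8" "totient 20 = 8" "totient 24 = 8" by code_simp+
  then have "\<not> 15 dvd n" "\<not> 20 dvd n" "\<not> 24 dvd n"
    using small[of 15] small[of 20] small[of 24] by auto
  then have "n \<in> set [1, 2, 3, 4, 5, 6, 8, 10, 12]"
    using cases by (simp only: mod_eq_0_iff_dvd simp_thms)
  moreover have "totient 3 = 2" by code_simp
  ultimately show ?thesis using assms by auto
qed

section \<open>Cyclic groups and at most one large cyclic subgroup\<close>

lemma (in group) ord_eq_2_iff:
  assumes "x \<in> carrier G"
  shows "ord x = 2 \<longleftrightarrow> x \<noteq> \<one> \<and> x \<otimes> x = \<one>"
proof -
  have "x \<otimes> x = \<one> \<longleftrightarrow> ord x dvd 2"
    using assms pow_eq_id[of x 2] by (simp add: numeral_2_eq_2)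
  also have "\<dots> \<longleftrightarrow> ord x = 1 \<or> ord x = 2"
    using prime_nat_iff two_is_prime_nat by auto
  finally show ?thesis using assms ord_eq_1 by auto
qed

text \<open>Write \<open>y = x [^] k\<close> with \<open>0 < k < ?n\<close>. Then \<open>?n\<close>
  divides \<open>2 * k\<close>, which is less than \<open>2 * ?n\<close>, so
  \<open>?n = 2 * k\<close>. In particular a finite cyclic group has at most one involution.\<close>

lemma (in group) involution_mem_generate:
  assumes fin: "finite (carrier G)" and x: "x \<in> carrier G" and y: "y \<in> generate G {x}" "ord y = 2"
  shows "even (ord x) \<and> y = x [^] (ord x div 2)"
proof -
  let ?n = "ord x"
  have "y \<in> {x [^] k | k. k \<in> {0..?n - 1}}"
    using y generate_pow_on_finite_carrier[OF fin x] ord_elems[OF fin x] by auto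
  then obtain k where k: "y = x [^] k" "k < ?n" using ord_ge_1[OF fin x] by fastforce
  have "y \<in> carrier G" using k x by simp
  then have "y [^] (2::nat) = \<one>" "y \<noteq> \<one>"
    using y(2) by (metis pow_ord_eq_1, auto)
  then have "?n dvd k * 2" "k \<noteq> 0"
    using k x by (auto simp: nat_pow_pow pow_eq_id intro: Nat.gr0I)
  then obtain j where j: "k * 2 = ?n * j" by (elim dvdE)
  with \<open>k \<noteq> 0\<close> have "j \<noteq> 0" by (intro notI) simp
  have "?n * j < ?n * 2" unfolding j[symmetric] using k(2) by simp
  then have "j = 1" using \<open>j \<noteq> 0\<close> by simp
  then have "?n = k * 2" using j by simp
  then show ?thesis using k(1) by simp
qed

lemma (in group) num_involutions_of_generator:
  assumes fin: "finite (carrier G)" and x: "x \<in> carrier G" "ord x = order G" "even (order G)"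
  shows "num_involutions G = 1"
proof -
  have full: "generate G {x} = carrier G"
    using x fin generate_pow_card[OF x(1)] generate_incl[of "{x}"]
    by (intro card_subset_eq) (auto simp: order_def)
  have pos: "order G > 0" using fin order_gt_0_iff_finite by simp
  have "ord (x [^] (ord x div 2)) = 2"
    using x pos by (subst ord_pow) (auto elim!: evenE)
  then have "{y \<in> carrier G. ord y = 2} = {x [^] (ord x div 2)}"
    using involution_mem_generate[OF fin x(1)] full x(1) by auto
  then show ?thesis by (simp add: num_involutions_def)
qed

text \<open>The map sending a residue \<open>k\<close> to \<open>x [^] k\<close> is an injective
  homomorphism, and equal cardinalities make it onto.\<close>

lemma (in group) iso_integer_mod_group_of_generator:
  assumes fin: "finite (carrier G)" and x: "x \<in> carrier G" "ord x = order G"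
  shows "G \<cong> integer_mod_group (order G)"
proof -
  let ?n = "order G"
  have pos: "?n > 0" using fin order_gt_0_iff_finite by simp
  let ?h = "\<lambda>k::int. x [^] k"
  have car: "carrier (integer_mod_group ?n) = {0..<int ?n}"
    using pos by (simp add: carrier_integer_mod_group)
  have "?h \<in> hom (integer_mod_group ?n) G"
  proof (rule homI)
    fix a b assume "a \<in> carrier (integer_mod_group ?n)" "b \<in> carrier (integer_mod_group ?n)"
    have "x [^] ((a + b) mod int ?n) = x [^] (a + b)"
      using x by (simp add: int_pow_eq mod_eq_dvd_iff[symmetric])
    then show "x [^] (a \<otimes>\<^bsub>integer_mod_group ?n\<^esub> b) = x [^] a \<otimes> x [^] b"
      using x by (simp add: int_pow_mult)
  qed (use x in simp)
  moreover have inj: "inj_on ?h {0..<int ?n}"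
  proof (rule inj_onI)
    fix a b assume ab: "a \<in> {0..<int ?n}" "b \<in> {0..<int ?n}" "x [^] a = x [^] b"
    then have "int ?n dvd (b - a)" using x by (simp add: int_pow_eq)
    then have "b mod int ?n = a mod int ?n" by (simp add: mod_eq_dvd_iff)
    then show "a = b" using ab by simp
  qed
  moreover have "?h ` {0..<int ?n} = carrier G"
    using fin x inj by (intro card_subset_eq) (auto simp: card_image order_def)
  ultimately have "?h \<in> iso (integer_mod_group ?n) G"
    by (simp add: iso_def bij_betw_def car)
  then show ?thesis
    using group.iso_sym[OF group_integer_mod_group] is_isoI by blast
qed

text \<open>The image of the residue 1 has order \<open>n\<close> and hence generates
  \<open>G\<close>. This serves the directions of (3), (4) and (5) that start from the
  isomorphism.\<close>

lemma (in group) iso_integer_mod_group_num_involutions: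
  assumes n: "even n" "n > 0" and iso: "G \<cong> integer_mod_group n"
  shows "finite (carrier G) \<and> order G = n \<and> num_involutions G = 1"
proof -
  have car: "carrier (integer_mod_group n) = {0..<int n}"
    using n by (simp add: carrier_integer_mod_group)
  have "integer_mod_group n \<cong> G" by (rule iso_sym[OF iso])
  then obtain h where h: "h \<in> iso (integer_mod_group n) G" by (auto simp: is_iso_def)
  then have hom: "h \<in> hom (integer_mod_group n) G" and bij: "bij_betw h {0..<int n} (carrier G)"
    using car by (auto simp: iso_def)
  have fin: "finite (carrier G)" and ord: "order G = n"
    using bij_betw_finite[OF bij] bij_betw_same_card[OF bij] by (auto simp: order_def)
  have "n \<noteq> 1" using n by auto
  then have one: "1 \<in> {0..<int n}" using n by auto
  have x: "h 1 \<in> carrier G" using bij one bij_betwE by blast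
  have "h 1 [^] k = \<one> \<longleftrightarrow> n dvd k" for k :: nat
  proof -
    have "h 1 [^] k = h (1 [^]\<^bsub>integer_mod_group n\<^esub> k)"
      using hom_nat_pow[OF hom _ group_integer_mod_group is_group, of 1 k] one car by simp
    also have "\<dots> = h (int k mod int n)" by simp
    finally have "h 1 [^] k = \<one> \<longleftrightarrow> h (int k mod int n) = h 0"
      using hom_one[OF hom group_integer_mod_group is_group] by simp
    also have "\<dots> \<longleftrightarrow> int k mod int n = 0"
      using bij n by (intro inj_on_eq_iff[of h "{0..<int n}"]) (auto simp: bij_betw_def)
    also have "\<dots> \<longleftrightarrow> n dvd k" by (simp add: zmod_int[symmetric] mod_eq_0_iff_dvd)
    finally show ?thesis .
  qed
  then have "ord (h 1) = n" using ord_unique[OF x] by blast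
  then show ?thesis using num_involutions_of_generator[OF fin x] ord n fin by simp
qed

text \<open>Both equations come from eliminating between the count of elements and the count of
  cyclic subgroups. They are written without subtraction to stay exact over the naturals.\<close>

lemma half_cyclic_groupD:
  assumes "half_cyclic_group G"
  shows "group G" "finite (carrier G)"
    and "order G = 2 * num_involutions G + 2 * card (large_cyclic_subgroups G)"
    and "(\<Sum>H\<in>large_cyclic_subgroups G. totient (card H)) + 1 = num_involutions G + 2 * card (large_cyclic_subgroups G)"
proof -
  show "group G" and fin: "finite (carrier G)" using assms by (auto simp: half_cyclic_group_def)
  interpret group G by fact
  \<comment> \<open>Doubling clears the real half, after which the equation can be read over the
    naturals.\<close>
  have "real (2 * card (cyclic_subgroups G)) = real (order G + 2)"
    using assms by (simp add: half_cyclic_group_def field_simps)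
  then have "2 * card (cyclic_subgroups G) = order G + 2" by (simp only: of_nat_eq_iff)
  then show "order G = 2 * num_involutions G + 2 * card (large_cyclic_subgroups G)"
    and "(\<Sum>H\<in>large_cyclic_subgroups G. totient (card H)) + 1 = num_involutions G + 2 * card (large_cyclic_subgroups G)"
    using order_eq_sum_totient[OF fin] card_cyclic_subgroups_eq[OF fin] by simp_all
qed

lemma (in group) large_cyclic_subgroups_eq:
  "large_cyclic_subgroups G = (\<lambda>x. generate G {x}) ` {x \<in> carrier G. 3 \<le> ord x}"
  by (auto simp: large_cyclic_subgroups_def cyclic_subgroups_eq_generate simp flip: generate_pow_card)

text \<open>A divisor of 6 that is at least 3 is 3 or 6, both of totient 2, so every term
  \<open>totient (card H) - 2\<close> vanishes, matching a single involution.\<close>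

lemma (in group) half_cyclic_group_of_exponent_6:
  assumes fin: "finite (carrier G)" and exp: "\<And>x. x \<in> carrier G \<Longrightarrow> x [^] (6::nat) = \<one>"
    and inv: "num_involutions G = 1"
  shows "half_cyclic_group G"
proof -
  have "totient (card H) = 2" if "H \<in> large_cyclic_subgroups G" for H
  proof -
    obtain x where x: "x \<in> carrier G" "3 \<le> ord x" "H = generate G {x}"
      using \<open>H \<in> _\<close> by (auto simp: large_cyclic_subgroups_eq)
    have "ord x dvd 6" using exp x pow_eq_id by simp
    then have le: "ord x \<le> 6" and "6 mod ord x = 0" by (auto dest: dvd_imp_le)
    then have "ord x = 3 \<or> ord x = 6"
      using x(2) by (cases "ord x = 4"; cases "ord x = 5") auto
    then show ?thesis using x totient_prime[of 3] by (auto simp flip: generate_pow_card)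
  qed
  then have "(\<Sum>H\<in>large_cyclic_subgroups G. totient (card H)) = 2 * card (large_cyclic_subgroups G)"
    by simp
  then show ?thesis
    using order_eq_sum_totient[OF fin] card_cyclic_subgroups_eq[OF fin] inv fin
    by (simp add: half_cyclic_group_def is_group)
qed

text \<open>This turns (3), (4) and (5) into the cases of 0, 1 and 2 large cyclic subgroups.\<close>

lemma half_order_iff:
  assumes "half_cyclic_group G"
  shows "real (num_involutions G) = real (order G) / 2 - real k \<longleftrightarrow> card (large_cyclic_subgroups G) = k"
  using half_cyclic_groupD(3)[OF assms] by (auto simp: add_divide_distrib)

lemma half_cyclic_group_card_large_0:
  assumes half: "half_cyclic_group G" and "card (large_cyclic_subgroups G) = 0"
  shows "G \<cong> integer_mod_group 2"
proof -
  interpret group G using half half_cyclic_groupD by blast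
  note fin = half_cyclic_groupD(2)[OF half]
  have "large_cyclic_subgroups G = {}"
    using assms fin finite_cyclic_subgroups by (auto simp: large_cyclic_subgroups_def)
  then have "num_involutions G = 1" "order G = 2"
    using half_cyclic_groupD(3,4)[OF half] by auto
  then obtain x where "x \<in> carrier G" "ord x = 2"
    by (auto simp: num_involutions_def card_1_singleton_iff)
  then show ?thesis
    using iso_integer_mod_group_of_generator[OF fin] \<open>order G = 2\<close> by metis
qed

text \<open>The equations give \<open>order G = 2 * totient (ord x)\<close>, which is less than
  \<open>2 * ord x\<close>. As \<open>ord x\<close> divides the order, \<open>x\<close> generates
  \<open>G\<close>; a cyclic group of even order has one involution, and the order is then
  4.\<close>

lemma half_cyclic_group_card_large_1:
  assumes half: "half_cyclic_group G" and "card (large_cyclic_subgroups G) = 1"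
  shows "G \<cong> integer_mod_group 4"
proof -
  interpret group G using half half_cyclic_groupD by blast
  note fin = half_cyclic_groupD(2)[OF half] and ord = half_cyclic_groupD(3,4)[OF half]
  obtain H where H: "large_cyclic_subgroups G = {H}"
    using assms by (auto simp: card_1_singleton_iff)
  then obtain x where x: "x \<in> carrier G" "3 \<le> ord x" "H = generate G {x}"
    unfolding large_cyclic_subgroups_eq by blast
  have o: "order G = 2 * totient (ord x)"
    and i: "num_involutions G + 1 = totient (ord x)"
    using ord H x(3) generate_pow_card[OF x(1)] by auto
  obtain j where j: "order G = ord x * j" using ord_dvd_group_order[OF x(1)] by (elim dvdE)
  have "ord x * j < ord x * 2"
    unfolding j[symmetric] o using totient_less[of "ord x"] x(2) by simp
  moreover have "j \<noteq> 0" using j o x(2) by (intro notI) simp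
  ultimately have gen: "ord x = order G" using j by simp
  have "num_involutions G = 1"
    by (rule num_involutions_of_generator[OF fin x(1) gen]) (simp add: o)
  then have "order G = 4" using o i by simp
  then show ?thesis
    using iso_integer_mod_group_of_generator[OF fin x(1) gen] by simp
qed

section \<open>Groups with one involution\<close>

text \<open>An isomorphism preserves the order of each element. The example groups for (1) are
  carried to another type, and their involution count has to follow.\<close>

lemma (in group) num_involutions_image_iso:
  assumes "h \<in> iso G H" "group H"
  shows "num_involutions H = num_involutions G"
proof -
  interpret H: group H by fact
  have hom: "h \<in> hom G H" and bij: "bij_betw h (carrier G) (carrier H)"
    using assms by (auto simp: iso_def)
  have ord: "H.ord (h x) = ord x" if x: "x \<in> carrier G" for x
  proof -
    have "h x [^]\<^bsub>H\<^esub> k = \<one>\<^bsub>H\<^esub> \<longleftrightarrow> ord x dvd k" for k :: nat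
    proof -
      have "h x [^]\<^bsub>H\<^esub> k = \<one>\<^bsub>H\<^esub> \<longleftrightarrow> h (x [^] k) = h \<one>"
        using hom_nat_pow[OF hom x is_group assms(2)] hom_one[OF hom is_group assms(2)] by simp
      also have "\<dots> \<longleftrightarrow> x [^] k = \<one>"
        using bij x by (intro inj_on_eq_iff[of h "carrier G"]) (auto simp: bij_betw_def)
      finally show ?thesis using x pow_eq_id by simp
    qed
    moreover have "h x \<in> carrier H" using hom x by (rule hom_in_carrier)
    ultimately show ?thesis using H.ord_unique by blast
  qed
  have "{y \<in> carrier H. H.ord y = 2} = {y \<in> h ` carrier G. H.ord y = 2}"
    using bij by (simp add: bij_betw_def)
  also have "\<dots> = h ` {x \<in> carrier G. ord x = 2}" using ord by auto
  finally have "bij_betw h {x \<in> carrier G. ord x = 2} {y \<in> carrier H. H.ord y = 2}"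
    using bij by (auto simp: bij_betw_def intro: inj_on_subset)
  then have "card {x \<in> carrier G. ord x = 2} = card {y \<in> carrier H. H.ord y = 2}"
    by (rule bij_betw_same_card)
  then show ?thesis by (simp add: num_involutions_def)
qed

lemma (in group) inj_iso_image_group:
  assumes "inj_on f (carrier G)"
  shows "f \<in> iso G (image_group f G)" "group (image_group f G)"
proof -
  show iso: "f \<in> iso G (image_group f G)"
    using assms by (auto simp: iso_def hom_def bij_betw_def image_group_def)
  show "group (image_group f G)"
    using iso_imp_img_group[OF iso] by (simp add: image_group_def)
qed

text \<open>This is \<open>Z_6 x Z_3^k\<close>, with the factor of order 6 at index 0.\<close>

definition exp6_group :: "nat \<Rightarrow> (nat \<Rightarrow> int) monoid" where
  "exp6_group k = product_group {..k} (\<lambda>i. integer_mod_group (if i = 0 then 6 else 3))"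

lemma carrier_exp6_group:
  "carrier (exp6_group k) = (\<Pi>\<^sub>E i\<in>{..k}. {0..<(if i = 0 then 6 else 3)})"
  by (auto simp: exp6_group_def carrier_integer_mod_group PiE_def Pi_def)

lemma group_exp6_group: "group (exp6_group k)"
  by (simp add: exp6_group_def)

lemma order_exp6_group: "order (exp6_group k) = 6 * 3 ^ k"
proof -
  have "(\<Prod>i\<le>k. card {0..<(if i = 0 then 6 else 3 :: int)}) = 6 * 3 ^ k"
    by (induction k) auto
  then show ?thesis by (simp add: order_def carrier_exp6_group card_PiE)
qed

text \<open>Powers are computed coordinatewise, and a multiple of 6 vanishes modulo both 6 and
  3.\<close>

lemma exponent_exp6_group:
  assumes "x \<in> carrier (exp6_group k)"
  shows "x [^]\<^bsub>exp6_group k\<^esub> (6::nat) = \<one>\<^bsub>exp6_group k\<^esub>"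
proof -
  have "x [^]\<^bsub>exp6_group k\<^esub> n = (\<lambda>i\<in>{..k}. (int n * x i) mod (if i = 0 then 6 else 3))" for n
  proof (induction n)
    case (Suc n)
    have "(int n * x i mod m + x i) mod m = int (Suc n) * x i mod m" for i m
      unfolding mod_add_left_eq by (simp add: distrib_right add.commute)
    with Suc show ?case by (simp add: exp6_group_def fun_eq_iff)
  qed (simp add: exp6_group_def fun_eq_iff)
  from this[of 6] show ?thesis by (simp add: exp6_group_def fun_eq_iff)
qed

lemma num_involutions_exp6_group: "num_involutions (exp6_group k) = 1"
proof -
  interpret group "exp6_group k" by (rule group_exp6_group)
  \<comment> \<open>The only involution of the factor of order 6 is 3, and the factors of order 3
    have none.\<close>
  let ?z = "\<lambda>i\<in>{..k}. if i = 0 then 3 else 0 :: int"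
  have "{x \<in> carrier (exp6_group k). ord x = 2} = {?z}"
  proof (intro equalityI subsetI)
    fix x assume "x \<in> {x \<in> carrier (exp6_group k). ord x = 2}"
    then have x: "x \<in> carrier (exp6_group k)" "x \<noteq> \<one>\<^bsub>exp6_group k\<^esub>"
      "x \<otimes>\<^bsub>exp6_group k\<^esub> x = \<one>\<^bsub>exp6_group k\<^esub>"
      using ord_eq_2_iff by auto
    have ext: "x i = undefined" if "i \<notin> {..k}" for i
      using x(1) that by (auto simp: carrier_exp6_group PiE_def extensional_def)
    have dbl: "(x i + x i) mod (if i = 0 then 6 else 3) = 0" if "i \<le> k" for i
      using fun_cong[OF x(3), of i] that by (simp add: exp6_group_def split: if_splits)
    have x0: "x i = 0" if "i \<le> k" "i \<noteq> 0" for i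
    proof -
      have "x i \<in> {0..<3}" "(x i + x i) mod 3 = 0"
        using x(1) dbl[OF that(1)] that by (auto simp: carrier_exp6_group PiE_def Pi_def)
      then show ?thesis unfolding atLeastLessThan_iff by presburger
    qed
    have "x 0 \<in> {0..<6}" "(x 0 + x 0) mod 6 = 0"
      using x(1) dbl[of 0] by (auto simp: carrier_exp6_group PiE_def Pi_def)
    then have "x 0 = 0 \<or> x 0 = 3" unfolding atLeastLessThan_iff by presburger
    moreover have "x 0 \<noteq> 0"
    proof
      assume "x 0 = 0"
      then have "x i = \<one>\<^bsub>exp6_group k\<^esub> i" for i
        using x0[of i] ext[of i] by (cases "i \<le> k"; cases "i = 0") (simp_all add: exp6_group_def)
      then have "x = \<one>\<^bsub>exp6_group k\<^esub>" by (rule HOL.ext)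
      then show False using x(2) by simp
    qed
    ultimately have "x 0 = 3" by simp
    then have "x i = ?z i" for i using x0[of i] ext[of i] by (cases "i \<le> k"; cases "i = 0") simp_all
    then show "x \<in> {?z}" by (simp add: fun_eq_iff)
  next
    fix x assume x: "x \<in> {?z}"
    have "?z \<in> carrier (exp6_group k)" by (auto simp: carrier_exp6_group)
    moreover have "?z \<noteq> \<one>\<^bsub>exp6_group k\<^esub>"
    proof
      assume "?z = \<one>\<^bsub>exp6_group k\<^esub>"
      from fun_cong[OF this, of 0] show False by (simp add: exp6_group_def)
    qed
    moreover have "?z \<otimes>\<^bsub>exp6_group k\<^esub> ?z = \<one>\<^bsub>exp6_group k\<^esub>"
      by (auto simp: exp6_group_def fun_eq_iff restrict_def)
    ultimately show "x \<in> {x \<in> carrier (exp6_group k). ord x = 2}"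
      using x ord_eq_2_iff by blast
  qed
  then show ?thesis by (simp add: num_involutions_def)
qed

text \<open>The product group is finite, so it has a copy with carrier in the naturals; the family
  in (1) is asked for in the type \<open>nat monoid\<close>.\<close>

lemma exists_half_cyclic_group_nat:
  "\<exists>G :: nat monoid. half_cyclic_group G \<and> num_involutions G = 1 \<and> order G = 6 * 3 ^ k"
proof -
  interpret M: group "exp6_group k" by (rule group_exp6_group)
  have fin: "finite (carrier (exp6_group k))"
    by (simp add: carrier_exp6_group finite_PiE)
  then obtain f :: "(nat \<Rightarrow> int) \<Rightarrow> nat" where inj: "inj_on f (carrier (exp6_group k))"
    using finite_imp_inj_to_nat_seg by blast
  let ?N = "image_group f (exp6_group k)"
  note iso = M.inj_iso_image_group[OF inj]
  interpret N: group ?N by (rule iso(2))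
  have hom: "f \<in> hom (exp6_group k) ?N" using iso(1) by (simp add: iso_def)
  have inv: "num_involutions ?N = 1"
    using M.num_involutions_image_iso[OF iso] num_involutions_exp6_group by simp
  have "half_cyclic_group ?N"
  proof (rule N.half_cyclic_group_of_exponent_6)
    show "finite (carrier ?N)" using fin by (simp add: image_group_carrier)
    fix y assume "y \<in> carrier ?N"
    then obtain x where x: "x \<in> carrier (exp6_group k)" "y = f x" by (auto simp: image_group_carrier)
    show "y [^]\<^bsub>?N\<^esub> (6::nat) = \<one>\<^bsub>?N\<^esub>"
      using hom_nat_pow[OF hom x(1) M.is_group N.is_group, of 6] exponent_exp6_group[OF x(1)] x(2)
      by (simp add: image_group_one)
  qed (rule inv)
  moreover have "order ?N = 6 * 3 ^ k"
    using card_image[OF inj] order_exp6_group[of k] by (simp add: order_def image_group_carrier)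
  ultimately show ?thesis using inv by blast
qed

text \<open>The orders \<open>6 * 3 ^ k\<close> are pairwise distinct, so members with different
  index cannot be isomorphic.\<close>

lemma exists_infinite_half_cyclic_family:
  "\<exists>S :: nat monoid set. infinite S \<and>
     (\<forall>G\<in>S. half_cyclic_group G \<and> num_involutions G = 1) \<and>
     (\<forall>G\<in>S. \<forall>H\<in>S. G \<cong> H \<longrightarrow> G = H)"
proof -
  obtain F :: "nat \<Rightarrow> nat monoid" where
    F: "\<forall>k. half_cyclic_group (F k) \<and> num_involutions (F k) = 1 \<and> order (F k) = 6 * 3 ^ k"
    using choice[of "\<lambda>k G :: nat monoid. half_cyclic_group G \<and> num_involutions G = 1 \<and> order G = 6 * 3 ^ k"]
      exists_half_cyclic_group_nat by blast
  have inj: "j = k" if "order (F j) = order (F k)" for j k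
  proof -
    have "6 * 3 ^ j = (6 * 3 ^ k :: nat)" using F that by metis
    then show ?thesis by simp
  qed
  have "inj F"
  proof (rule injI)
    fix j k assume "F j = F k"
    then have "order (F j) = order (F k)" by simp
    then show "j = k" by (rule inj)
  qed
  then have "infinite (range F)" by (rule range_inj_infinite)
  moreover have "half_cyclic_group G \<and> num_involutions G = 1" if "G \<in> range F" for G
    using that F by auto
  moreover have "G = H" if GH: "G \<in> range F" "H \<in> range F" "G \<cong> H" for G H
  proof -
    obtain j k where jk: "G = F j" "H = F k" using GH(1,2) by blast
    have "order (F j) = order (F k)" using iso_same_card[OF GH(3)] by (simp add: order_def jk)
    then have "j = k" by (rule inj)
    then show ?thesis by (simp add: jk)
  qed
  ultimately show ?thesis by (intro exI[of _ "range F"] conjI ballI impI) blast+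
qed

section \<open>Two large cyclic subgroups\<close>

text \<open>The cofactor of \<open>d\<close> in \<open>m\<close> is odd and different from 1, hence
  at least 3.\<close>

lemma odd_dvd_totient_le:
  fixes d m :: nat
  assumes "odd m" "d dvd m" "d \<noteq> m"
  shows "3 * totient d \<le> m"
proof -
  obtain k where k: "m = d * k" using assms(2) by (elim dvdE)
  have "odd k" using assms(1) k by simp
  moreover have "k \<noteq> 1" using assms(3) k by auto
  ultimately have "3 \<le> k" by (cases "k = 2") (auto elim!: oddE)
  then have "d * 3 \<le> m" using k by simp
  then show ?thesis using totient_le[of d] by simp
qed

text \<open>Squaring keeps an odd order and halves an order \<open>2 * j\<close> with
  \<open>j\<close> odd, and \<open>totient (2 * j) = totient j\<close> for odd
  \<open>j\<close>.\<close>

lemma (in group) totient_ord_square: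
  assumes "x \<in> carrier G" "ord x = n" "\<not> 4 dvd n"
  shows "totient (ord (x [^] (2::nat))) = totient n"
proof (cases "even n")
  case True
  then obtain j where j: "n = 2 * j" by (elim evenE)
  with assms(3) have "odd j" by (auto elim!: evenE)
  moreover have "ord (x [^] (2::nat)) = j" using j assms by (simp add: ord_pow)
  ultimately show ?thesis using j by (simp add: totient_double)
next
  case False
  then have "ord (x [^] (2::nat)) = n" using assms by (simp add: ord_pow_gen)
  then show ?thesis by simp
qed

section \<open>Conjugation and products with an involution\<close>

lemma (in group) conjugate_pow:
  assumes "x \<in> carrier G" "y \<in> carrier G"
  shows "(x \<otimes> y \<otimes> inv x) [^] (n::nat) = x \<otimes> y [^] n \<otimes> inv x"
proof (induction n)
  case (Suc n)
  have "inv x \<otimes> (x \<otimes> z) = z" if "z \<in> carrier G" for z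
    using assms that by (simp flip: m_assoc)
  then have "(x \<otimes> y [^] n \<otimes> inv x) \<otimes> (x \<otimes> y \<otimes> inv x) = x \<otimes> y [^] n \<otimes> y \<otimes> inv x"
    using assms by (simp add: m_assoc)
  with Suc show ?case using assms by (simp add: m_assoc)
qed (use assms in simp)

lemma (in group) ord_conjugate:
  assumes "x \<in> carrier G" "y \<in> carrier G"
  shows "ord (x \<otimes> y \<otimes> inv x) = ord y"
proof -
  note conjugate_pow[OF assms]
  moreover have "x \<otimes> z \<otimes> inv x = \<one> \<longleftrightarrow> z = \<one>" if "z \<in> carrier G" for z
    using assms(1) that by (metis inv_solve_right' l_cancel_one m_closed one_closed r_inv l_one r_cancel_one)
  ultimately show ?thesis using assms ord_unique[of "x \<otimes> y \<otimes> inv x" "ord y"] pow_eq_id by simp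
qed

text \<open>Pigeonhole: the conjugates of \<open>t\<close> by the powers of \<open>x\<close> with
  exponents 0 to \<open>card S\<close> all lie in \<open>S\<close>, so two coincide, and the
  difference of their exponents is \<open>d\<close>.\<close>

lemma (in group) exists_commuting_power:
  assumes S: "finite S" "S \<subseteq> carrier G" and t: "t \<in> S" and x: "x \<in> carrier G"
    and closed: "\<And>s. s \<in> S \<Longrightarrow> x \<otimes> s \<otimes> inv x \<in> S"
  obtains d :: nat where "1 \<le> d" "d \<le> card S" "x [^] d \<otimes> t = t \<otimes> x [^] d"
proof -
  have tc: "t \<in> carrier G" using S t by auto
  let ?f = "\<lambda>k::nat. x [^] k \<otimes> t \<otimes> inv (x [^] k)"
  have "?f k \<in> S" for k
  proof (induction k)
    case (Suc k)
    have "?f (Suc k) = x \<otimes> ?f k \<otimes> inv x"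
      unfolding nat_pow_Suc2[OF x] using x tc by (simp add: inv_mult_group m_assoc)
    then show ?case using closed[OF Suc] by simp
  qed (use t tc in simp)
  then have "card (?f ` {0..card S}) \<le> card S" by (intro card_mono S) auto
  then have "\<not> inj_on ?f {0..card S}" using card_image[of ?f "{0..card S}"] by auto
  then obtain a b where ab: "a < b" "b \<le> card S" "?f a = ?f b"
    unfolding inj_on_def by (metis atLeastAtMost_iff linorder_neqE_nat)
  define d where "d = b - a"
  have "?f b = x [^] a \<otimes> (x [^] d \<otimes> t \<otimes> inv (x [^] d)) \<otimes> inv (x [^] a)"
  proof -
    have "x [^] b = x [^] a \<otimes> x [^] d" using x ab by (simp add: nat_pow_mult d_def)
    then show ?thesis using x tc by (simp add: inv_mult_group m_assoc)
  qed
  then have "x [^] d \<otimes> t \<otimes> inv (x [^] d) = t" using ab(3) x tc by simp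
  then have "x [^] d \<otimes> t = t \<otimes> x [^] d"
    using x tc by (metis inv_solve_right m_closed nat_pow_closed)
  then show ?thesis using ab by (intro that[of d]) (auto simp: d_def)
qed

text \<open>The power \<open>(t \<otimes> x) [^] k\<close> is
  \<open>t [^] k \<otimes> x [^] k\<close>. For odd \<open>k\<close> it cannot be trivial, as that
  would put \<open>t\<close> into \<open>generate G {x}\<close>.\<close>

lemma (in group) ord_mult_commuting_involution:
  assumes x: "x \<in> carrier G" and t: "t \<in> carrier G" "ord t = 2" and comm: "t \<otimes> x = x \<otimes> t"
    and nin: "t \<notin> generate G {x}" and "ord x \<noteq> 0"
  shows "ord (t \<otimes> x) = lcm 2 (ord x)"
proof -
  have tt: "t [^] k = (if even k then \<one> else t)" for k :: nat
    using t by (induction k) (auto simp: ord_eq_2_iff)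
  have "(t \<otimes> x) [^] k = \<one> \<longleftrightarrow> lcm 2 (ord x) dvd k" for k :: nat
  proof -
    have *: "(t \<otimes> x) [^] k = t [^] k \<otimes> x [^] k"
      by (rule pow_mult_distrib[OF comm t(1) x])
    show ?thesis
    proof (cases "even k")
      case True
      then show ?thesis using * tt x by (simp add: pow_eq_id)
    next
      case False
      have "t \<otimes> x [^] k \<noteq> \<one>"
      proof
        assume "t \<otimes> x [^] k = \<one>"
        then have "t = inv (x [^] k)" using x t inv_equality by simp
        moreover have "x [^] k \<in> generate G {x}"
          unfolding generate_pow_nat[OF x \<open>ord x \<noteq> 0\<close>] by auto
        ultimately show False
          using nin subgroup.m_inv_closed[OF generate_is_subgroup, of "{x}" "x [^] k"] x by simp
      qed
      then show ?thesis using False * tt by auto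
    qed
  qed
  then show ?thesis using ord_unique x t by blast
qed

lemma (in group) conjugate_eq_self_iff:
  assumes "x \<in> carrier G" "y \<in> carrier G"
  shows "x \<otimes> y \<otimes> inv x = y \<longleftrightarrow> y \<otimes> x = x \<otimes> y"
  using assms by (metis inv_solve_right' m_closed)

text \<open>The hypothesis says that \<open>t\<close> inverts \<open>c\<close>, so \<open>t\<close>
  and \<open>c\<close> generate a dihedral group whose reflections
  \<open>t \<otimes> c [^] k\<close> are \<open>ord c\<close> distinct involutions.\<close>

lemma (in group) involutions_if_inverted:
  assumes fin: "finite (carrier G)" and c: "c \<in> carrier G" and t: "t \<in> carrier G" "ord t = 2"
    and tc: "(t \<otimes> c) \<otimes> (t \<otimes> c) = \<one>" and nin: "t \<notin> generate G {c}"
  shows "ord c \<le> num_involutions G"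
proof -
  have cgen: "subgroup (generate G {c}) G" using c generate_is_subgroup by simp
  have tt: "t \<otimes> t = \<one>" using t ord_eq_2_iff by simp
  \<comment> \<open>This form of the inversion avoids inverses and extends to all powers of
    \<open>c\<close> by induction.\<close>
  have ctc: "c \<otimes> t \<otimes> c = t"
  proof -
    have "t \<otimes> (c \<otimes> t \<otimes> c) = t \<otimes> t" using tc tt c t by (simp add: m_assoc)
    then show ?thesis using c t by simp
  qed
  have pow: "c [^] k \<otimes> t \<otimes> c [^] k = t" for k :: nat
  proof (induction k)
    case (Suc k)
    have "c [^] Suc k \<otimes> t \<otimes> c [^] Suc k = c [^] k \<otimes> c \<otimes> t \<otimes> (c \<otimes> c [^] k)"
      using nat_pow_Suc2[OF c] by simp
    also have "\<dots> = c [^] k \<otimes> (c \<otimes> t \<otimes> c) \<otimes> c [^] k"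
      using c t by (simp add: m_assoc)
    finally show ?case using ctc Suc by simp
  qed (use t in simp)
  have "t \<otimes> c [^] k \<in> {x \<in> carrier G. ord x = 2}" for k :: nat
  proof -
    have "(t \<otimes> c [^] k) \<otimes> (t \<otimes> c [^] k) = t \<otimes> (c [^] k \<otimes> t \<otimes> c [^] k)"
      using c t by (simp add: m_assoc)
    moreover have "t \<otimes> c [^] k \<noteq> \<one>"
    proof
      assume "t \<otimes> c [^] k = \<one>"
      then have "t = inv (c [^] k)" using c t inv_equality by simp
      moreover have "c [^] k \<in> generate G {c}" using mem_generate_iff[OF fin c] by blast
      ultimately show False using nin subgroup.m_inv_closed[OF cgen, of "c [^] k"] by simp
    qed
    ultimately have "ord (t \<otimes> c [^] k) = 2"
      using pow[of k] tt c t by (subst ord_eq_2_iff) simp_all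
    then show ?thesis using c t by simp
  qed
  then have "(\<lambda>k. t \<otimes> c [^] k) ` {1..ord c} \<subseteq> {x \<in> carrier G. ord x = 2}" by blast
  then have "card ((\<lambda>k. t \<otimes> c [^] k) ` {1..ord c}) \<le> num_involutions G"
    unfolding num_involutions_def using fin by (intro card_mono) auto
  moreover have "inj_on (\<lambda>k. t \<otimes> c [^] k) {1..ord c}"
  proof (rule inj_onI)
    fix j k assume "j \<in> {1..ord c}" "k \<in> {1..ord c}" "t \<otimes> c [^] j = t \<otimes> c [^] k"
    then show "j = k" using c t by (intro inj_onD[OF ord_inj'[OF c]]) simp_all
  qed
  ultimately show ?thesis by (simp add: card_image)
qed

text \<open>With \<open>order G = 2 * m\<close>, the two totients add up to \<open>m + 1\<close>,
  which forces \<open>m\<close> to be odd and to be the order of some \<open>c\<close>. For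
  \<open>m = 3\<close> the only involution commutes with \<open>c\<close>, giving order 6; larger
  \<open>m\<close> would give too many involutions.\<close>

lemma half_cyclic_group_card_large_2:
  fixes G (structure)
  assumes half: "half_cyclic_group G" and card2: "card (large_cyclic_subgroups G) = 2"
  shows "G \<cong> integer_mod_group 6"
proof -
  interpret group G using half half_cyclic_groupD by blast
  note fin = half_cyclic_groupD(2)[OF half] and ords = half_cyclic_groupD(3,4)[OF half]
  let ?I = "{x \<in> carrier G. ord x = 2}"
  define m where "m = num_involutions G + 2"
  have o: "order G = 2 * m" using ords(1) card2 by (simp add: m_def)
  obtain H K where HK: "large_cyclic_subgroups G = {H, K}" "H \<noteq> K"
    using card2 by (auto simp: card_2_iff)
  then have "H \<in> large_cyclic_subgroups G" "K \<in> large_cyclic_subgroups G" by auto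
  then obtain x y where x: "x \<in> carrier G" "3 \<le> ord x" "H = generate G {x}"
    and y: "y \<in> carrier G" "3 \<le> ord y" "K = generate G {y}"
    unfolding large_cyclic_subgroups_eq by blast
  have sum: "totient (ord x) + totient (ord y) = m + 1"
    using ords(2) HK x y card2 by (simp add: m_def flip: generate_pow_card)
  \<comment> \<open>Both totients are even, since \<open>ord x\<close> and \<open>ord y\<close>
    exceed 2.\<close>
  have "even (m + 1)"
    unfolding sum[symmetric] using x y totient_even[of "ord x"] totient_even[of "ord y"] by simp
  then have odd: "odd m" by simp
  have not4: "\<not> 4 dvd ord z" if "z \<in> carrier G" for z
  proof
    assume "4 dvd ord z"
    then have "2 * 2 dvd 2 * m" using ord_dvd_group_order[OF that] o dvd_trans by fastforce
    then show False using odd by simp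
  qed
  have sq: "ord (z [^] (2::nat)) dvd m" if "z \<in> carrier G" for z
  proof -
    have "(z [^] (2::nat)) [^] m = \<one>" using that pow_order_eq_1[OF that] o by (simp add: nat_pow_pow)
    then show ?thesis using that pow_eq_id by simp
  qed
  have tot: "totient (ord (z [^] (2::nat))) = totient (ord z)" if "z \<in> carrier G" for z
    using totient_ord_square[OF that refl not4[OF that]] .
  \<comment> \<open>Squares have order dividing the odd \<open>m\<close>, with unchanged totient. If
    no order equals \<open>m\<close>, each totient is at most a third of \<open>m\<close>, too small
    for the sum \<open>m + 1\<close>.\<close>
  have "\<exists>c \<in> carrier G. ord c = m"
  proof (rule ccontr)
    assume none: "\<not> (\<exists>c \<in> carrier G. ord c = m)"
    have "3 * totient (ord z) \<le> m" if "z \<in> carrier G" for z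
      using odd_dvd_totient_le[OF odd sq[OF that]] tot[OF that] none that by auto
    from this[OF x(1)] this[OF y(1)] show False using sum by linarith
  qed
  then obtain c where c: "c \<in> carrier G" "ord c = m" by blast
  have m2: "3 \<le> m"
  proof -
    have "totient (ord x) > 1" "totient (ord y) > 1"
      using x(2) y(2) totient_gt_1[of "ord x"] totient_gt_1[of "ord y"] by auto
    then show ?thesis using sum by simp
  qed
  have nin: "t \<notin> generate G {c}" if "t \<in> ?I" for t
    using involution_mem_generate[OF fin c(1)] that c(2) odd by auto
  have finI: "finite ?I" using fin by simp
  have cardI: "card ?I = m - 2" by (simp add: m_def num_involutions_def)
  show ?thesis
  proof (cases "m = 3")
    case True
    then have "card ?I = 1" using cardI by simp
    then obtain t where t: "?I = {t}" by (auto simp: card_1_singleton_iff)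
    then have tI: "t \<in> carrier G" "ord t = 2" by auto
    have "c \<otimes> t \<otimes> inv c \<in> ?I" using ord_conjugate[OF c(1) tI(1)] tI c(1) by simp
    then have "t \<otimes> c = c \<otimes> t" using t conjugate_eq_self_iff[OF c(1) tI(1)] by auto
    then have "ord (t \<otimes> c) = lcm 2 m"
      using ord_mult_commuting_involution[OF c(1) tI _ nin] tI c(2) True by simp
    then have "ord (t \<otimes> c) = 6" using True by (simp add: lcm_nat_def)
    then show ?thesis
      using iso_integer_mod_group_of_generator[OF fin, of "t \<otimes> c"] o True tI c(1) by simp
  next
    case False
    then have m5: "5 \<le> m" using m2 odd by (cases "m = 4") auto
    let ?C = "generate G {c}" and ?J = "(\<lambda>t. t \<otimes> c) ` ?I"
    have sub: "subgroup ?C G" using c(1) generate_is_subgroup by simp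
    have cardC: "card ?C = m" using generate_pow_card c by metis
    \<comment> \<open>\<open>?C\<close> has index 2, so its complement is the one other coset; it
      contains every involution \<open>t\<close> and every product
      \<open>t \<otimes> c\<close>.\<close>
    have "card (carrier G - ?C) = m"
    proof -
      have "?C \<subseteq> carrier G" using sub by (rule subgroup.subset)
      then have "card (carrier G - ?C) = card (carrier G) - card ?C"
        using fin by (intro card_Diff_subset) (auto intro: finite_subset)
      then show ?thesis using cardC o by (simp add: order_def)
    qed
    moreover have "?I \<subseteq> carrier G - ?C" using nin by auto
    moreover have "?J \<subseteq> carrier G - ?C"
    proof -
      have "t \<otimes> c \<notin> ?C" if "t \<in> ?I" for t
      proof
        assume "t \<otimes> c \<in> ?C"
        then have "t \<otimes> c \<otimes> inv c \<in> ?C"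
          by (rule subgroup.m_closed[OF sub _ subgroup.m_inv_closed[OF sub mem_generate_self]])
        moreover have "t \<otimes> c \<otimes> inv c = t" using that c(1) by (simp add: m_assoc)
        ultimately show False using nin[OF that] by simp
      qed
      then show ?thesis using c(1) by auto
    qed
    moreover have "card ?J = m - 2"
      using cardI c(1) by (subst card_image) (auto simp: inj_on_def)
    ultimately have le: "card (?I \<union> ?J) \<le> m" and J: "card ?J = m - 2"
      using card_mono[of "carrier G - ?C" "?I \<union> ?J"] fin by simp_all
    \<comment> \<open>Two subsets of size \<open>m - 2\<close> in a coset of size \<open>m \<ge> 5\<close> must meet,
      so some involution inverts \<open>c\<close>, which yields \<open>m\<close> involutions.\<close>
    have "?I \<inter> ?J \<noteq> {}"
    proof
      assume "?I \<inter> ?J = {}"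
      then have "card (?I \<union> ?J) = card ?I + card ?J"
        by (rule card_Un_disjoint[OF finI finite_imageI[OF finI]])
      then show False using cardI J le m5 by linarith
    qed
    then obtain t where t: "t \<in> ?I" "t \<otimes> c \<in> ?I" by auto
    then have "(t \<otimes> c) \<otimes> (t \<otimes> c) = \<one>" using ord_eq_2_iff[of "t \<otimes> c"] by simp
    then have "ord c \<le> num_involutions G"
      using involutions_if_inverted[OF fin c(1) _ _ _ nin[OF t(1)]] t(1) by simp
    then show ?thesis using c(2) m_def by simp
  qed
qed

section \<open>Three involutions\<close>

text \<open>The excesses \<open>totient (card H) - 2\<close> are even and add up to 2, so exactly
  one of them is 2 and the others are 0.\<close>

lemma half_cyclic_group_3_involutions:
  assumes half: "half_cyclic_group G" and inv: "num_involutions G = 3"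
  obtains c where "c \<in> carrier G" "totient (group.ord G c) = 4"
    and "\<And>y. y \<in> carrier G \<Longrightarrow> totient (group.ord G y) = 4 \<Longrightarrow> generate G {y} = generate G {c}"
proof -
  interpret group G using half half_cyclic_groupD by blast
  note fin = half_cyclic_groupD(2)[OF half]
  let ?L = "large_cyclic_subgroups G"
  have finL: "finite ?L" using fin finite_cyclic_subgroups by (simp add: large_cyclic_subgroups_def)
  \<comment> \<open>The truncated subtraction is exact on \<open>?L\<close>, where totients are at
    least 2.\<close>
  define g where "g H = totient (card H) - 2" for H :: "'a set"
  have phi: "totient (card H) = g H + 2" "even (g H)" if "H \<in> ?L" for H
  proof -
    have "2 < card H" using that by (simp add: large_cyclic_subgroups_def)
    then show "totient (card H) = g H + 2" "even (g H)"
      using totient_gt_1[of "card H"] totient_even[of "card H"] by (auto simp: g_def)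
  qed
  have "(\<Sum>H\<in>?L. totient (card H)) = (\<Sum>H\<in>?L. g H + 2)" using phi(1) by (rule sum.cong[OF refl])
  also have "\<dots> = (\<Sum>H\<in>?L. g H) + 2 * card ?L" by (simp only: sum.distrib) simp
  finally have sum: "(\<Sum>H\<in>?L. g H) = 2" using half_cyclic_groupD(4)[OF half] inv by simp
  then obtain H where H: "H \<in> ?L" "g H \<noteq> 0" by (metis sum.neutral zero_neq_numeral)
  have "g H + (\<Sum>K\<in>?L - {H}. g K) = 2" using sum sum.remove[OF finL H(1), of g] by simp
  moreover have "2 \<le> g H" using phi(2)[OF H(1)] H(2) by (cases "g H = 1") auto
  ultimately have gH: "g H = 2" and rest: "(\<Sum>K\<in>?L - {H}. g K) = 0" by linarith+
  have others: "g K = 0" if "K \<in> ?L" "K \<noteq> H" for K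
  proof -
    have "\<forall>K\<in>?L - {H}. g K = 0" using rest finL by (subst sum_eq_0_iff[symmetric]) simp_all
    then show ?thesis using that by blast
  qed
  obtain c where c: "c \<in> carrier G" "H = generate G {c}"
    using H(1) unfolding large_cyclic_subgroups_eq by blast
  show ?thesis
  proof
    show "c \<in> carrier G" by fact
    show "totient (ord c) = 4" using phi(1)[OF H(1)] gH c by (simp flip: generate_pow_card)
    fix y assume y: "y \<in> carrier G" "totient (ord y) = 4"
    have "3 \<le> ord y"
    proof (rule ccontr)
      assume "\<not> 3 \<le> ord y"
      then have "ord y \<in> {0, 1, 2}" by auto
      then show False using y(2) by auto
    qed
    then have mem: "generate G {y} \<in> ?L" unfolding large_cyclic_subgroups_eq using y(1) by auto
    then have "g (generate G {y}) = 2" using phi(1)[OF mem] y by (simp flip: generate_pow_card)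
    then have "generate G {y} = H" using others[OF mem] by fastforce
    then show "generate G {y} = generate G {c}" using c(2) by simp
  qed
qed

lemma dvd_8_not_dvd_4:
  fixes n :: nat
  assumes "n dvd 8" "\<not> n dvd 4"
  shows "n = 8"
proof -
  obtain k where "k \<le> 3" "n = 2 ^ k"
    using assms(1) divides_primepow_nat[of 2 n 3] by auto
  moreover have "\<not> k \<le> 2"
    using assms(2) le_imp_power_dvd[of k 2 "2::nat"] \<open>n = 2 ^ k\<close> by auto
  ultimately have "k = 3" by simp
  then show ?thesis using \<open>n = 2 ^ k\<close> by simp
qed

lemma card_2_other:
  assumes "card S = 2" "t \<in> S" "u \<in> S" "v \<in> S" "u \<noteq> t" "v \<noteq> t"
  shows "u = v"
  using assms by (auto simp: card_2_iff)

text \<open>All elements whose order has totient 4 generate the same subgroup \<open>?C\<close>.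
  Each case produces such an element of another order or outside \<open>?C\<close>, or else a fourth
  involution.\<close>

lemma no_half_cyclic_group_3_involutions:
  fixes G (structure)
  assumes half: "half_cyclic_group G" and inv: "num_involutions G = 3"
  shows False
proof -
  interpret group G using half half_cyclic_groupD by blast
  note fin = half_cyclic_groupD(2)[OF half]
  let ?I = "{x \<in> carrier G. ord x = 2}"
  have finI: "finite ?I" using fin by simp
  have cardI: "card ?I = 3" using inv by (simp add: num_involutions_def)
  obtain c where c: "c \<in> carrier G" "totient (ord c) = 4"
    and uniq: "\<And>y. y \<in> carrier G \<Longrightarrow> totient (ord y) = 4 \<Longrightarrow> generate G {y} = generate G {c}"
    using half_cyclic_group_3_involutions[OF half inv] by metis
  let ?C = "generate G {c}"
  have sub: "subgroup ?C G" using c(1) generate_is_subgroup by simp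
  have cC: "c \<in> ?C" by (rule mem_generate_self)
  have ord_uniq: "ord y = ord c" if "y \<in> carrier G" "totient (ord y) = 4" for y
    using uniq[OF that] generate_pow_card that(1) c(1) by metis
  have in_C: "y \<in> ?C" if "y \<in> carrier G" "totient (ord y) = 4" for y
    using uniq[OF that] mem_generate_self by blast
  have conj: "c \<otimes> s \<otimes> inv c \<in> ?I" if "s \<in> ?I" for s
    using that ord_conjugate[OF c(1)] c(1) by simp
  have tot5: "totient 5 = 4" by code_simp
  have tot10: "totient 10 = 4" by code_simp
  have pos: "ord c \<noteq> 0" using c(2) by (intro notI) simp
  from totient_eq_4_imp[OF c(2)] consider "ord c = 5" | "ord c = 10" | "ord c = 8 \<or> ord c = 12" by auto
  then show False
  proof cases
    case 1
    have "?I \<noteq> {}" using cardI by (intro notI) simp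
    then obtain t where t: "t \<in> ?I" unfolding ex_in_conv[symmetric] by (elim exE)
    then have tI: "t \<in> carrier G" "ord t = 2" by auto
    have nin: "t \<notin> ?C" using involution_mem_generate[OF fin c(1) _ tI(2)] 1 by auto
    have "?I \<subseteq> carrier G" by auto
    \<comment> \<open>Some \<open>c [^] d\<close> with \<open>d\<close> at most 3 commutes with
      \<open>t\<close> and still generates \<open>?C\<close>, as \<open>d\<close> is coprime to 5.
      Its product with \<open>t\<close> has order 10, again of totient 4.\<close>
    then obtain d where d: "1 \<le> d" "d \<le> card ?I" "c [^] d \<otimes> t = t \<otimes> c [^] d"
      by (rule exists_commuting_power[OF finI _ t c(1) conj])
    have "d \<le> 3" using d(2) unfolding cardI .
    then have "d \<in> {1, 2, 3}" using d(1) by auto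
    moreover have "coprime 1 (5::nat)" "coprime 2 (5::nat)" "coprime 3 (5::nat)" by code_simp+
    ultimately have "coprime d 5" by auto
    then have od: "ord (c [^] d) = 5" using pow_ord_eq_ord_iff[OF fin c(1)] 1 by simp
    have "generate G {c [^] d} = ?C" using uniq[of "c [^] d"] od tot5 c(1) by simp
    then have "ord (t \<otimes> c [^] d) = lcm 2 5"
      using ord_mult_commuting_involution[OF _ tI, of "c [^] d"] d(3) od nin c(1) by simp
    then have "ord (t \<otimes> c [^] d) = 10" by (simp add: lcm_nat_def)
    then show False using ord_uniq[of "t \<otimes> c [^] d"] tot10 1 tI(1) c(1) by simp
  next
    case 2
    have "ord (c [^] (2::nat)) = 5" using 2 c(1) by (simp add: ord_pow)
    then show False using ord_uniq[of "c [^] (2::nat)"] tot5 2 c(1) by simp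
  next
    case 3
    \<comment> \<open>The unique involution of \<open>?C\<close>, both for order 8 and for order
      12.\<close>
    define z where "z = c [^] (ord c div 2)"
    have even: "even (ord c)" using 3 by auto
    have zcar: "z \<in> carrier G" using c(1) by (simp add: z_def)
    have ordz: "ord z = 2" unfolding z_def using 3 c(1) by (subst ord_pow) auto
    have zI: "z \<in> ?I" using zcar ordz by simp
    have zc: "c \<otimes> z = z \<otimes> c" unfolding z_def
      using nat_pow_Suc2[OF c(1), of "ord c div 2"] by simp
    have onlyz: "s = z" if "s \<in> ?C" "ord s = 2" for s
      using involution_mem_generate[OF fin c(1) that] by (simp add: z_def)
    have zz: "z \<otimes> z = \<one>" using ord_eq_2_iff[OF zcar] ordz by simp
    have card2: "card (?I - {z}) = 2"
      using card_Diff_singleton[OF zI] cardI by linarith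
    then have "?I - {z} \<noteq> {}" by (intro notI) simp
    then obtain t where t: "t \<in> ?I - {z}" by (auto simp only: ex_in_conv[symmetric])
    then have tI: "t \<in> carrier G" "ord t = 2" "t \<noteq> z" by auto
    have tt: "t \<otimes> t = \<one>" using ord_eq_2_iff[OF tI(1)] tI(2) by simp
    have t_inv: "inv t = t" using inv_equality[OF tt tI(1) tI(1)] .
    have nin: "t \<notin> ?C" using onlyz tI by blast
    \<comment> \<open>Conjugating \<open>c\<close> by \<open>t\<close> preserves its order, so the
      result stays in \<open>?C\<close>. Hence \<open>t\<close> conjugates \<open>z\<close> to an
      involution of \<open>?C\<close>, which can only be \<open>z\<close>.\<close>
    have tz: "t \<otimes> z = z \<otimes> t"
    proof -
      let ?c' = "t \<otimes> c \<otimes> inv t"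
      have c': "?c' \<in> carrier G" "ord ?c' = ord c" using ord_conjugate[OF tI(1) c(1)] tI(1) c(1) by auto
      then have "?c' \<in> ?C" using in_C[OF c'(1)] c(2) by simp
      then obtain k where "?c' = c [^] (k::nat)" using mem_generate_iff[OF fin c(1)] by auto
      then have "?c' [^] (ord c div 2) = c [^] (k * (ord c div 2))"
        using c(1) by (simp only: nat_pow_pow)
      moreover have "t \<otimes> z \<otimes> inv t = ?c' [^] (ord c div 2)"
        unfolding z_def by (rule conjugate_pow[OF tI(1) c(1), symmetric])
      ultimately have "t \<otimes> z \<otimes> inv t = c [^] (k * (ord c div 2))" by (simp only:)
      then have "t \<otimes> z \<otimes> inv t \<in> ?C"
        unfolding mem_generate_iff[OF fin c(1)] by (rule exI)
      then have "t \<otimes> z \<otimes> inv t = z"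
        using ord_conjugate[OF tI(1) zcar] ordz by (intro onlyz) simp_all
      then show ?thesis using conjugate_eq_self_iff[OF tI(1) zcar] by simp
    qed
    \<comment> \<open>Conjugation by \<open>c\<close> fixes \<open>z\<close> and must swap the other two involutions \<open>t\<close> and \<open>t \<otimes> z\<close>.\<close>
    have nocomm: "c \<otimes> t \<noteq> t \<otimes> c"
    proof
      assume "c \<otimes> t = t \<otimes> c"
      \<comment> \<open>As \<open>ord c\<close> is even, this equals \<open>ord c\<close>, so
        \<open>t \<otimes> c\<close> would lie in \<open>?C\<close>, and \<open>t\<close> with
        it.\<close>
      then have "ord (t \<otimes> c) = lcm 2 (ord c)"
        using ord_mult_commuting_involution[OF c(1) tI(1,2) _ nin pos] by simp
      also have "\<dots> = ord c" using even by (simp add: lcm_proj2_if_dvd)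
      finally have "t \<otimes> c \<in> ?C" using in_C[of "t \<otimes> c"] c tI(1) by simp
      then have "t \<otimes> c \<otimes> inv c \<in> ?C"
        by (rule subgroup.m_closed[OF sub _ subgroup.m_inv_closed[OF sub cC]])
      then show False using nin tI(1) c(1) by (simp add: m_assoc)
    qed
    have closed: "c \<otimes> s \<otimes> inv c \<in> ?I - {z}" if s: "s \<in> ?I - {z}" for s
    proof -
      have "c \<otimes> s \<otimes> inv c \<noteq> z"
      proof
        assume "c \<otimes> s \<otimes> inv c = z"
        then have "c \<otimes> s = c \<otimes> z" using s c(1) zcar inv_solve_right'[of z "c \<otimes> s" c] zc by simp
        then show False using s c(1) zcar by simp
      qed
      then show ?thesis using conj s by blast
    qed
    have "t \<otimes> z \<in> ?I - {z}"
    proof -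
      have "(t \<otimes> z) \<otimes> (t \<otimes> z) = t \<otimes> (z \<otimes> t) \<otimes> z"
        using tI(1) zcar by (simp add: m_assoc)
      also have "\<dots> = t \<otimes> t \<otimes> (z \<otimes> z)"
        unfolding tz[symmetric] using tI(1) zcar by (simp add: m_assoc)
      finally have "(t \<otimes> z) \<otimes> (t \<otimes> z) = \<one>" using tt zz by simp
      moreover have "t \<otimes> z \<noteq> \<one>"
        using tI(1,3) inv_equality[of t z] zcar inv_equality[OF zz zcar zcar] by metis
      ultimately have "ord (t \<otimes> z) = 2" using tI(1) zcar by (subst ord_eq_2_iff) simp_all
      moreover have "t \<otimes> z \<noteq> z" using tI zcar ord_eq_2_iff[OF tI(1)] by simp
      ultimately show ?thesis using tI(1) zcar by simp
    qed
    moreover have "t \<otimes> z \<noteq> t" using ord_eq_2_iff[OF zcar] tI(1) zcar ordz by simp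
    moreover have "c \<otimes> t \<otimes> inv c \<noteq> t" using nocomm conjugate_eq_self_iff[OF c(1) tI(1)] by simp
    ultimately have "c \<otimes> t \<otimes> inv c = t \<otimes> z"
      by (intro card_2_other[OF card2 t closed[OF t]])
    then have ct: "c \<otimes> t = t \<otimes> z \<otimes> c"
      using c(1) tI(1) zcar by (simp add: inv_solve_right')
    have tct: "t \<otimes> c \<otimes> t = z \<otimes> c"
    proof -
      have "t \<otimes> c \<otimes> t = t \<otimes> (c \<otimes> t)" using tI(1) c(1) by (simp add: m_assoc)
      also have "\<dots> = t \<otimes> t \<otimes> z \<otimes> c" unfolding ct using tI(1) c(1) zcar by (simp add: m_assoc)
      finally show ?thesis using tt zcar c(1) by simp
    qed
    have sq: "(t \<otimes> c) \<otimes> (t \<otimes> c) = z \<otimes> (c \<otimes> c)"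
    proof -
      have "(t \<otimes> c) \<otimes> (t \<otimes> c) = (t \<otimes> c \<otimes> t) \<otimes> c" using tI(1) c(1) by (simp add: m_assoc)
      then show ?thesis unfolding tct using c(1) zcar by (simp add: m_assoc)
    qed
    show False
    proof (cases "ord c = 8")
      case True
      \<comment> \<open>Here \<open>z\<close> is the fourth power of \<open>c\<close>. Consequently
        the 8th power of \<open>t \<otimes> c\<close> is \<open>c [^] 24\<close>, which is trivial,
        and its 4th power is \<open>c [^] 12\<close>, which is not.\<close>
      have "(t \<otimes> c) [^] (2::nat) = c [^] (6::nat)"
      proof -
        have "(t \<otimes> c) [^] (2::nat) = z \<otimes> (c \<otimes> c)"
          using sq c(1) tI(1) by (simp add: numeral_2_eq_2)
        also have "c \<otimes> c = c [^] (2::nat)" using c(1) by (simp add: numeral_2_eq_2)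
        finally show ?thesis using c(1) True by (simp add: z_def nat_pow_mult)
      qed
      then have tc2: "(t \<otimes> c) [^] (2 * k) = c [^] (6 * k)" for k :: nat
        using c(1) tI(1) by (simp flip: nat_pow_pow)
      have "ord (t \<otimes> c) dvd 8" 
        using tc2[of 4] pow_eq_id[of "t \<otimes> c" 8] pow_eq_id[OF c(1), of 24] True c(1) tI(1) by simp
      moreover have "\<not> ord (t \<otimes> c) dvd 4" 
        using tc2[of 2] pow_eq_id[of "t \<otimes> c" 4] pow_eq_id[OF c(1), of 12] True c(1) tI(1) by simp
      ultimately have "ord (t \<otimes> c) = 8"
        using dvd_8_not_dvd_4 by blast
      then have "t \<otimes> c \<in> ?C" using in_C[of "t \<otimes> c"] c tI(1) True by simp
      then have "t \<otimes> c \<otimes> inv c \<in> ?C"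
        by (rule subgroup.m_closed[OF sub _ subgroup.m_inv_closed[OF sub cC]])
      then show False using nin tI(1) c(1) by (simp add: m_assoc)
    next
      case False
      then have ord12: "ord c = 12" using 3 by simp
      \<comment> \<open>Here \<open>z\<close> is the sixth power of \<open>c\<close>, so conjugation
        by \<open>t\<close> sends \<open>c\<close> to its 7th power and \<open>?b\<close> to
        \<open>c [^] 21\<close>, the inverse of \<open>?b\<close>. As \<open>?b\<close> has order 4,
        this yields four involutions.\<close>
      let ?b = "c [^] (3::nat)"
      have ordb: "ord ?b = 4" using ord12 c(1) by (simp add: ord_pow)
      have "t \<notin> generate G {?b}"
      proof -
        have "generate G {?b} \<subseteq> ?C"
          using sub mem_generate_iff[OF fin c(1)] by (intro generate_subgroup_incl) auto
        then show ?thesis using nin by blast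
      qed
      moreover have "(t \<otimes> ?b) \<otimes> (t \<otimes> ?b) = \<one>"
      proof -
        have ttu: "t \<otimes> (t \<otimes> u) = u" if "u \<in> carrier G" for u
          using that tI(1) tt by (simp flip: m_assoc)
        have "t \<otimes> ?b \<otimes> (t \<otimes> ?b) = (t \<otimes> c \<otimes> t) \<otimes> (t \<otimes> c \<otimes> t) \<otimes> (t \<otimes> c \<otimes> t) \<otimes> ?b"
          using tI(1) c(1) ttu by (simp add: m_assoc numeral_eq_Suc)
        also have "\<dots> = (z \<otimes> c) \<otimes> (z \<otimes> c) \<otimes> (z \<otimes> c) \<otimes> ?b" unfolding tct ..
        also have "z \<otimes> c = c [^] (7::nat)"
          using nat_pow_mult[OF c(1), of 6 1] c(1) ord12 by (simp add: z_def)
        also have "c [^] (7::nat) \<otimes> c [^] (7::nat) \<otimes> c [^] (7::nat) \<otimes> ?b = c [^] (24::nat)"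
          using c(1) by (simp add: nat_pow_mult)
        also have "\<dots> = \<one>" using c(1) ord12 by (simp add: pow_eq_id)
        finally show ?thesis .
      qed
      ultimately have "ord ?b \<le> 3"
        using involutions_if_inverted[OF fin _ tI(1,2), of ?b] inv c(1) by simp
      then show False using ordb by simp
    qed
  qed
qed

section \<open>Assembling the five statements\<close>

theorem theorem1p4:
  shows "(\<exists>S :: nat monoid set. infinite S \<and>
            (\<forall>G\<in>S. half_cyclic_group G \<and> num_involutions G = 1) \<and>
            (\<forall>G\<in>S. \<forall>H\<in>S. G \<cong> H \<longrightarrow> G = H)) \<and>
         (\<nexists>G :: 'a monoid. half_cyclic_group G \<and> num_involutions G = 3) \<and>
         (\<forall>G :: 'a monoid. half_cyclic_group G \<longrightarrow>
            (real (num_involutions G) = real (order G) / 2 \<longleftrightarrow> G \<cong> integer_mod_group 2)) \<and>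
         (\<forall>G :: 'a monoid. half_cyclic_group G \<longrightarrow>
            (real (num_involutions G) = real (order G) / 2 - 1 \<longleftrightarrow> G \<cong> integer_mod_group 4)) \<and>
         (\<forall>G :: 'a monoid. half_cyclic_group G \<longrightarrow>
            (real (num_involutions G) = real (order G) / 2 - 2 \<longleftrightarrow> G \<cong> integer_mod_group 6))"
proof (intro conjI allI impI)
  show "\<exists>S :: nat monoid set. infinite S \<and>
            (\<forall>G\<in>S. half_cyclic_group G \<and> num_involutions G = 1) \<and>
            (\<forall>G\<in>S. \<forall>H\<in>S. G \<cong> H \<longrightarrow> G = H)"
    by (rule exists_infinite_half_cyclic_family)
  show "\<nexists>G :: 'a monoid. half_cyclic_group G \<and> num_involutions G = 3"
    using no_half_cyclic_group_3_involutions by blast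
next
  fix G :: "'a monoid"
  assume half: "half_cyclic_group G"
  interpret group G using half by (rule half_cyclic_groupD(1))
  have *: "order G = n" "num_involutions G = 1" if "even n" "n > 0" "G \<cong> integer_mod_group n" for n
    using iso_integer_mod_group_num_involutions[OF that] by simp_all
  note iff = half_order_iff[OF half]
  \<comment> \<open>Here and below, the direction from the isomorphism is arithmetic: one involution
    and order 2, 4 or 6 give \<open>1 = n / 2 - k\<close> with \<open>k\<close> equal to 0, 1 or
    2.\<close>
  show "real (num_involutions G) = real (order G) / 2 \<longleftrightarrow> G \<cong> integer_mod_group 2"
    using iff[of 0] half_cyclic_group_card_large_0[OF half] *[of 2] by auto
  show "real (num_involutions G) = real (order G) / 2 - 1 \<longleftrightarrow> G \<cong> integer_mod_group 4"
    using iff[of 1] half_cyclic_group_card_large_1[OF half] *[of 4] by auto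
  show "real (num_involutions G) = real (order G) / 2 - 2 \<longleftrightarrow> G \<cong> integer_mod_group 6"
    using iff[of 2] half_cyclic_group_card_large_2[OF half] *[of 6] by auto
qed

end
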